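(* Let $K:\mathbb{F}_N^+\times\mathbb{F}_N^+\to\mathbb{C}$ be a positive definite multi-Toeplitz kernel with $K(\emptyset,\emptyset)=1$, and let $S=[S_{ij}]_{i,j=0}^{\infty}$ be the array of operators $S_{ij}=[K(\sigma,\tau)]_{|\sigma|=i,|\tau|=j}\in\mathcal{L}(\mathcal{H}_j,\mathcal{H}_i)$ associated to $K$. Then $$S-\sum_{k=1}^N C_k S C_k^*=GJG^*,$$ where $$G=\begin{bmatrix} 1 & 0\\ S_{01}^* & S_{01}^*\\ S_{02}^* & S_{02}^*\\ \vdots & \vdots\end{bmatrix},\qquad J=\begin{bmatrix}1&0\\0&-1\end{bmatrix}.$$ The equality is understood as an equality of infinite arrays of operators (products being computed entrywise by the usual rule of block matrix multiplication), acting on the terminating sequences in $\bigoplus_{l\ge 0}\mathcal{H}_l$.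
   Context: Fix an integer $N\ge 1$. $\mathbb{F}_N^+$ is the unital free semigroup on generators $1,\dots,N$; its elements are words, $\emptyset$ is the empty word (identity), $|\sigma|$ is the length of $\sigma$, and words of a given length are listed in lexicographic order. $\mathcal{H}_k$ ($k\ge 0$) is the Hilbert space $\mathbb{C}^{N^k}$ with orthonormal basis $\{e_\sigma\}_{|\sigma|=k}$ listed in lexicographic order; for $k\ge1$, $\mathcal{H}_k$ is identified with the direct sum of $N$ copies of $\mathcal{H}_{k-1}$, the $j$-th copy being spanned by the $e_{j\sigma}$, $|\sigma|=k-1$ ($e_{j\sigma}$ corresponding to $e_\sigma$ in the $j$-th copy). For $k=1,\dots,N$, $C_k=[T^k_{ij}]_{i,j=0}^\infty$ is the isometry on $\bigoplus_{l=0}^\infty\mathcal{H}_l$ with $T^k_{ij}=0$ for $i\neq j+1$ and $T^k_{i+1,i}:\mathcal{H}_i\to\mathcal{H}_{i+1}=\mathcal{H}_i^{\oplus N}$ the block column with $N$ blocks, all zero except the $k$-th, which is $I_{\mathcal{H}_i}$. $K:\mathbb{F}_N^+\times\mathbb{F}_N^+\to\mathbb{C}$ is a positive definite kernel if $\sum_{i,j=1}^m K(\sigma_i,\sigma_j)\lambda_j\overline{\lambda_i}\ge 0$ for all $m\geq 1$, words $\sigma_1,\dots,\sigma_m$ and complex numbers $\lambda_1,\dots,\lambda_m$. It is multi-Toeplitz if it is invariant, i.e. $K(\tau\sigma,\tau\sigma')=K(\sigma,\sigma')$ for all words $\tau,\sigma,\sigma'$, and $K(\sigma,\tau)=0$ whenever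 there is no word $\alpha$ with $\sigma=\tau\alpha$ or $\tau=\sigma\alpha$. *)

theory Defs
  imports
    "Jordan_Normal_Form.Matrix"
    "Jordan_Normal_Form.Schur_Decomposition"
begin

text \<open>
  Words of the free semigroup on \<open>1, \<dots>, N\<close> are the lists in \<open>lists {1..N}\<close>; the product is
  concatenation and the identity is \<open>[]\<close>.
\<close>

text \<open>
  The words of length \<open>k\<close> in lexicographic order; position \<open>p < N ^ k\<close> of this list
  is the position of the basis vector of the word \<open>words N k ! p\<close> in \<open>\<complex>\<^bsup>N^k\<^esup>\<close>.
\<close>

definition words :: "nat \<Rightarrow> nat \<Rightarrow> nat list list" where
  "words N k = product_lists (replicate k [1..<Suc N])"

lemma words_0 [simp]: "words N 0 = [[]]"
  by (simp add: words_def)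

lemma words_Suc: "words N (Suc k) = concat (map (\<lambda>j. map ((#) j) (words N k)) [1..<Suc N])"
  by (simp add: words_def)

lemma length_words: "length (words N k) = N ^ k"
  by (induction k) (simp_all add: words_Suc length_concat comp_def sum_list_triv)

lemma set_words: "set (words N k) = {w \<in> lists {1..N}. length w = k}"
proof (induction k)
  case (Suc k)
  have "set (words N (Suc k)) = (\<Union>j\<in>{1..N}. (#) j ` {w \<in> lists {1..N}. length w = k})"
    using Suc by (simp add: words_Suc atLeastLessThanSuc_atLeastAtMost del: upt_Suc)
  also have "\<dots> = {w \<in> lists {1..N}. length w = Suc k}"
    by (auto simp: length_Suc_conv image_iff)
  finally show ?case .
qed auto

lemma sorted_words: "sorted_wrt ord_class.lexordp (words N k)"
proof (induction k)
  case (Suc k)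
  have "sorted_wrt ord_class.lexordp (concat (map (\<lambda>j. map ((#) j) (words N k)) js))"
    if "sorted_wrt (<) js" for js :: "nat list"
    using that Suc by (induction js) (auto simp: sorted_wrt_append sorted_wrt_map)
  then show ?case
    by (simp add: words_Suc del: upt_Suc)
qed simp

text \<open>
  The order on \<^typ>\<open>complex\<close> is that of \<^theory>\<open>HOL-Library.Complex_Order\<close>:
  \<open>0 \<le> z\<close> says that \<open>z\<close> is real and nonnegative.
\<close>

definition positive_definite_kernel :: "nat \<Rightarrow> (nat list \<Rightarrow> nat list \<Rightarrow> complex) \<Rightarrow> bool" where
  "positive_definite_kernel N K \<longleftrightarrow>
     (\<forall>m\<ge>1. \<forall>\<sigma> :: nat \<Rightarrow> nat list. \<forall>c :: nat \<Rightarrow> complex.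
        (\<forall>i\<in>{1..m}. \<sigma> i \<in> lists {1..N}) \<longrightarrow>
        0 \<le> (\<Sum>i=1..m. \<Sum>j=1..m. K (\<sigma> i) (\<sigma> j) * c j * cnj (c i)))"

definition multi_Toeplitz :: "nat \<Rightarrow> (nat list \<Rightarrow> nat list \<Rightarrow> complex) \<Rightarrow> bool" where
  "multi_Toeplitz N K \<longleftrightarrow>
     (\<forall>\<tau>\<in>lists {1..N}. \<forall>\<sigma>\<in>lists {1..N}. \<forall>\<sigma>'\<in>lists {1..N}. K (\<tau> @ \<sigma>) (\<tau> @ \<sigma>') = K \<sigma> \<sigma>') \<and>
     (\<forall>\<sigma>\<in>lists {1..N}. \<forall>\<tau>\<in>lists {1..N}.
        \<not> (\<exists>\<alpha>\<in>lists {1..N}. \<sigma> = \<tau> @ \<alpha> \<or> \<tau> = \<sigma> @ \<alpha>) \<longrightarrow> K \<sigma> \<tau> = 0)"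

text \<open>
  An infinite array of operators: entry \<open>i j\<close> is the matrix, with respect to the lexicographically
  ordered bases, of an operator \<open>\<complex>\<^bsup>N^j\<^esup> \<rightarrow> \<complex>\<^bsup>N^i\<^esup>\<close>, that is, an \<open>N^i \<times> N^j\<close> matrix.
  Subtraction of arrays is pointwise subtraction of functions.
\<close>

type_synonym op_array = "nat \<Rightarrow> nat \<Rightarrow> complex mat"

definition array_adjoint :: "op_array \<Rightarrow> op_array" where
  "array_adjoint A = (\<lambda>i j. mat_adjoint (A j i))"

text \<open>
  The block product has entries \<open>\<Sum>l. A i l * B l j\<close>. Matrices of unspecified size do not form
  a monoid, so the sum is taken in each scalar entry. When one factor is \<open>creation N k\<close> or its
  adjoint (below), on the left or on the right respectively, at most one summand is nonzero.
\<close>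

definition array_mult :: "nat \<Rightarrow> op_array \<Rightarrow> op_array \<Rightarrow> op_array" where
  "array_mult N A B = (\<lambda>i j. mat (N ^ i) (N ^ j) (\<lambda>(p, q). \<Sum>l. (A i l * B l j) $$ (p, q)))"

definition array_sum :: "nat \<Rightarrow> (nat \<Rightarrow> op_array) \<Rightarrow> nat set \<Rightarrow> op_array" where
  "array_sum N F I = (\<lambda>i j. mat (N ^ i) (N ^ j) (\<lambda>(p, q). \<Sum>k\<in>I. F k i j $$ (p, q)))"

text \<open>
  The block column with \<open>N\<close> blocks of size \<open>n \<times> n\<close> (block \<open>b\<close>, counted from 1, occupies the rows
  \<open>p\<close> with \<open>p div n + 1 = b\<close>), all zero except the \<open>k\<close>-th, which is the identity.
\<close>

definition unit_block_column :: "nat \<Rightarrow> nat \<Rightarrow> nat \<Rightarrow> complex mat" where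
  "unit_block_column N n k =
     mat (N * n) n (\<lambda>(p, q). (if p div n + 1 = k then 1\<^sub>m n else 0\<^sub>m n n) $$ (p mod n, q))"

text \<open>
  The array of the isometry \<open>C\<^sub>k\<close>. In the lexicographic order the words of length \<open>i + 1\<close> beginning
  with \<open>j\<close> occupy the \<open>j\<close>-th block of \<open>N ^ i\<close> consecutive positions, which is the identification
  of \<open>\<complex>\<^bsup>N^(i+1)\<^esup>\<close> with the direct sum of \<open>N\<close> copies of \<open>\<complex>\<^bsup>N^i\<^esup>\<close>.
\<close>

definition creation :: "nat \<Rightarrow> nat \<Rightarrow> op_array" where
  "creation N k =
     (\<lambda>i j. if i = j + 1 then unit_block_column N (N ^ j) k else 0\<^sub>m (N ^ i) (N ^ j))"

definition kernel_array :: "nat \<Rightarrow> (nat list \<Rightarrow> nat list \<Rightarrow> complex) \<Rightarrow> op_array" where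
  "kernel_array N K =
     (\<lambda>i j. mat (N ^ i) (N ^ j) (\<lambda>(p, q). K (words N i ! p) (words N j ! q)))"

text \<open>
  \<open>G\<close> has two block columns with domain \<open>\<complex>\<close>. Its \<open>i\<close>-th block row is the operator
  \<open>\<complex>\<^sup>2 \<rightarrow> \<complex>\<^bsup>N^i\<^esup>\<close> whose \<open>N^i \<times> 2\<close> matrix has the two blocks as its columns.
\<close>

definition G_row :: "op_array \<Rightarrow> nat \<Rightarrow> complex mat" where
  "G_row S i =
     (if i = 0 then mat_of_rows_list 2 [[1, 0]]
      else mat_of_cols (dim_col (S 0 i))
             [col (mat_adjoint (S 0 i)) 0, col (mat_adjoint (S 0 i)) 0])"

definition J_mat :: "complex mat" where
  "J_mat = mat_of_rows_list 2 [[1, 0], [0, -1]]"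

text \<open>The array \<open>G J G\<^sup>*\<close>; \<open>G\<close> has a single column of operators \<open>G_row S i\<close>.\<close>

definition GJG_array :: "op_array \<Rightarrow> op_array" where
  "GJG_array S = (\<lambda>i j. G_row S i * J_mat * mat_adjoint (G_row S j))"

end

theory Submission
  imports Defs
begin

text \<open>
  Conjugation by \<open>C\<^sub>k\<close> moves the entry of \<open>S\<close> at \<open>(\<sigma>, \<tau>)\<close> to \<open>(k\<sigma>, k\<tau>)\<close>, where \<open>S\<close> has the same entry by
  invariance. So subtracting all \<open>C\<^sub>k S C\<^sub>k\<^sup>*\<close> removes the entries at nonempty words with the same first
  letter; those at nonempty words with different first letters vanish already. What remains of
  \<open>S\<close> is its block row 0 and its block column 0, which are adjoint to each other, and this is
  \<open>G J G\<^sup>*\<close>.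
\<close>

lemma dim_mat_adjoint [simp]:
  "dim_row (mat_adjoint A) = dim_col A" "dim_col (mat_adjoint A) = dim_row A"
  by (simp_all add: mat_adjoint_def)

lemma index_mat_adjoint:
  "i < dim_col A \<Longrightarrow> j < dim_row A \<Longrightarrow> mat_adjoint A $$ (i, j) = conjugate (A $$ (j, i))"
  by (simp add: mat_adjoint_def mat_of_rows_index)

lemma mod_power_less:
  fixes p N i :: nat
  assumes "p < N ^ Suc i"
  shows "p mod N ^ i < N ^ i" "p div N ^ i < N"
proof -
  \<comment> \<open>The bound on \<open>p\<close> rules out \<open>N ^ Suc i = 0\<close>, hence also
    \<open>N ^ i = 0\<close>.\<close>
  have pos: "N ^ i > 0"
    using assms by (cases "N ^ i") auto
  then show "p mod N ^ i < N ^ i"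
    by simp
  show "p div N ^ i < N"
    using assms by (simp add: less_mult_imp_div_less)
qed

lemma nth_concat_equal_lengths:
  assumes "\<And>x. x \<in> set xs \<Longrightarrow> length (f x) = n" "p < length xs * n"
  shows "concat (map f xs) ! p = f (xs ! (p div n)) ! (p mod n)"
  using assms
proof (induction xs arbitrary: p)
  case (Cons x xs)
  show ?case
  proof (cases "p < n")
    case False
    have "n > 0"
      using Cons.prems(2) by (cases n) auto
    have "concat (map f xs) ! (p - n) = f (xs ! ((p - n) div n)) ! ((p - n) mod n)"
      using Cons False by (intro Cons.IH) auto
    then show ?thesis
      using False \<open>n > 0\<close> Cons.prems(1)[of x] by (simp add: nth_append le_div_geq le_mod_geq)
  qed (use Cons.prems(1)[of x] in \<open>simp add: nth_append\<close>)
qed simp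

text \<open>Prefixing the letters in increasing order cuts the list into blocks of
  \<open>N ^ i\<close> consecutive words: the quotient by \<open>N ^ i\<close> gives the first
  letter, the remainder the position of the rest. \<open>Suc\<close> appears because letters start
  at 1 and quotients at 0. This turns invariance under prefixing a letter into a statement on matrix
  indices.\<close>

lemma nth_words_Suc:
  assumes "p < N ^ Suc i"
  shows "words N (Suc i) ! p = Suc (p div N ^ i) # words N i ! (p mod N ^ i)"
proof -
  have "words N (Suc i) ! p
      = map ((#) ([1..<Suc N] ! (p div N ^ i))) (words N i) ! (p mod N ^ i)"
    unfolding words_Suc using assms
    by (intro nth_concat_equal_lengths) (simp_all add: length_words del: upt_Suc)
  then show ?thesis
    using mod_power_less[OF assms] by (simp add: length_words del: upt_Suc)
qed

lemma nth_words_in_lists: "p < N ^ k \<Longrightarrow> words N k ! p \<in> lists {1..N}"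
  using set_words[of N k] nth_mem[of p "words N k"] by (auto simp: length_words)

lemma creation_carrier: "creation N k i j \<in> carrier_mat (N ^ i) (N ^ j)"
  by (simp add: creation_def unit_block_column_def)

lemma index_creation_Suc:
  "p < N ^ Suc i \<Longrightarrow> q < N ^ i \<Longrightarrow>
    creation N k (Suc i) i $$ (p, q) = (if Suc (p div N ^ i) = k \<and> p mod N ^ i = q then 1 else 0)"
  using mod_power_less[of p N i] by (simp add: creation_def unit_block_column_def)

lemma creation_eq_0: "i \<noteq> Suc j \<Longrightarrow> creation N k i j = 0\<^sub>m (N ^ i) (N ^ j)"
  by (simp add: creation_def)

lemma mat_adjoint_zero [simp]: "mat_adjoint (0\<^sub>m m n) = (0\<^sub>m n m :: complex mat)"
  by (rule eq_matI) (simp_all add: index_mat_adjoint)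

lemma creation_mult_0:
  assumes "\<And>i j. A i j \<in> carrier_mat (N ^ i) (N ^ j)"
  shows "array_mult N (creation N k) A 0 j = 0\<^sub>m (N ^ 0) (N ^ j)"
  by (rule eq_matI) (auto simp: array_mult_def creation_eq_0 left_mult_zero_mat[OF assms])

text \<open>Block row \<open>Suc i\<close> of \<open>creation N k\<close> vanishes except at block
  column \<open>i\<close>. There row \<open>p\<close> contains a 1, in column
  \<open>p mod N ^ i\<close>, exactly when \<open>p\<close> lies in the \<open>k\<close>-th
  block.\<close>

lemma creation_mult_Suc:
  assumes A: "\<And>i j. A i j \<in> carrier_mat (N ^ i) (N ^ j)"
    and p: "p < N ^ Suc i" and q: "q < N ^ j"
  shows "array_mult N (creation N k) A (Suc i) j $$ (p, q)
    = (if Suc (p div N ^ i) = k then A i j $$ (p mod N ^ i, q) else 0)"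
proof -
  have "array_mult N (creation N k) A (Suc i) j $$ (p, q)
      = (\<Sum>l. (creation N k (Suc i) l * A l j) $$ (p, q))"
    using p q by (simp add: array_mult_def)
  \<comment> \<open>For \<open>l\<close> other than \<open>i\<close> the left factor is a zero
    matrix of matching size, so the series is supported on \<open>{i}\<close>.\<close>
  also have "\<dots> = (creation N k (Suc i) i * A i j) $$ (p, q)"
    by (subst suminf_finite[of "{i}"])
      (use p q in \<open>auto simp: creation_eq_0 left_mult_zero_mat[OF A]\<close>)
  also have "\<dots> = (\<Sum>r = 0..<N ^ i. creation N k (Suc i) i $$ (p, r) * A i j $$ (r, q))"
    using p q A[of i j] creation_carrier[of N k "Suc i" i] by (auto simp: scalar_prod_def)
  also have "\<dots> = (\<Sum>r = 0..<N ^ i. if r = p mod N ^ i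
      then (if Suc (p div N ^ i) = k then A i j $$ (p mod N ^ i, q) else 0) else 0)"
    by (rule sum.cong) (use p in \<open>auto simp: index_creation_Suc simp del: power_Suc\<close>)
  also have "\<dots> = (if Suc (p div N ^ i) = k then A i j $$ (p mod N ^ i, q) else 0)"
    using mod_power_less[OF p] by simp
  finally show ?thesis .
qed

lemma mult_creation_adjoint_0:
  assumes "\<And>i j. A i j \<in> carrier_mat (N ^ i) (N ^ j)"
  shows "array_mult N A (array_adjoint (creation N k)) i 0 = 0\<^sub>m (N ^ i) (N ^ 0)"
  by (rule eq_matI)
    (auto simp: array_mult_def array_adjoint_def creation_eq_0 right_mult_zero_mat[OF assms])

text \<open>The mirror image of \<open>creation_mult_Suc\<close>: the adjoint exchanges rows and
  columns, and conjugation fixes the entries 0 and 1.\<close>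

lemma mult_creation_adjoint_Suc:
  assumes A: "\<And>i j. A i j \<in> carrier_mat (N ^ i) (N ^ j)"
    and p: "p < N ^ i" and q: "q < N ^ Suc j"
  shows "array_mult N A (array_adjoint (creation N k)) i (Suc j) $$ (p, q)
    = (if Suc (q div N ^ j) = k then A i j $$ (p, q mod N ^ j) else 0)"
proof -
  have "array_mult N A (array_adjoint (creation N k)) i (Suc j) $$ (p, q)
      = (\<Sum>l. (A i l * mat_adjoint (creation N k (Suc j) l)) $$ (p, q))"
    using p q by (simp add: array_mult_def array_adjoint_def)
  also have "\<dots> = (A i j * mat_adjoint (creation N k (Suc j) j)) $$ (p, q)"
    by (subst suminf_finite[of "{j}"])
      (use p q in \<open>auto simp: creation_eq_0 right_mult_zero_mat[OF A]\<close>)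
  also have "\<dots> = (\<Sum>r = 0..<N ^ j. A i j $$ (p, r) * mat_adjoint (creation N k (Suc j) j) $$ (r, q))"
    using p q A[of i j] creation_carrier[of N k "Suc j" j] by (auto simp: scalar_prod_def)
  also have "\<dots> = (\<Sum>r = 0..<N ^ j. if r = q mod N ^ j
      then (if Suc (q div N ^ j) = k then A i j $$ (p, q mod N ^ j) else 0) else 0)"
    by (rule sum.cong)
      (use q creation_carrier[of N k "Suc j" j] in
        \<open>auto simp: index_mat_adjoint index_creation_Suc simp del: power_Suc\<close>)
  also have "\<dots> = (if Suc (q div N ^ j) = k then A i j $$ (p, q mod N ^ j) else 0)"
    using mod_power_less[OF q] by simp
  finally show ?thesis .
qed

lemma array_mult_carrier: "array_mult N A B i j \<in> carrier_mat (N ^ i) (N ^ j)"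
  by (simp add: array_mult_def)

lemma kernel_array_carrier: "kernel_array N K i j \<in> carrier_mat (N ^ i) (N ^ j)"
  by (simp add: kernel_array_def)

lemma index_kernel_array:
  "p < N ^ i \<Longrightarrow> q < N ^ j \<Longrightarrow> kernel_array N K i j $$ (p, q) = K (words N i ! p) (words N j ! q)"
  by (simp add: kernel_array_def)

text \<open>The left factor selects the rows of the \<open>k\<close>-th block and the right factor
  its columns. The remainders are the positions of the two words with their first letter
  \<open>k\<close> removed.\<close>

lemma index_creation_conjugate:
  assumes A: "\<And>i j. A i j \<in> carrier_mat (N ^ i) (N ^ j)"
    and p: "p < N ^ i" and q: "q < N ^ j"
  shows "array_mult N (array_mult N (creation N k) A) (array_adjoint (creation N k)) i j $$ (p, q)
    = (case (i, j) of
        (Suc i', Suc j') \<Rightarrow> if Suc (p div N ^ i') = k \<and> Suc (q div N ^ j') = k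
          then A i' j' $$ (p mod N ^ i', q mod N ^ j') else 0
      | _ \<Rightarrow> 0)"
proof (cases j)
  case 0
  then show ?thesis
    using p q by (auto simp: mult_creation_adjoint_0[OF array_mult_carrier] split: nat.split)
next
  case (Suc j')
  then have q': "q mod N ^ j' < N ^ j'"
    using mod_power_less q by auto
  show ?thesis
  proof (cases i)
    case 0
    then show ?thesis
      using p q q' Suc
      by (auto simp: mult_creation_adjoint_Suc[OF array_mult_carrier] creation_mult_0[OF A]
          simp del: power_Suc)
  next
    case (Suc i')
    then show ?thesis
      using p q q' \<open>j = Suc j'\<close>
      by (auto simp: mult_creation_adjoint_Suc[OF array_mult_carrier] creation_mult_Suc[OF A]
          simp del: power_Suc)
  qed
qed

lemma positive_definite_kernel_diagonal:
  assumes "positive_definite_kernel N K" "\<sigma> \<in> lists {1..N}"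
  shows "0 \<le> K \<sigma> \<sigma>"
  using assms(1)[unfolded positive_definite_kernel_def, rule_format, of 1 "\<lambda>_. \<sigma>" "\<lambda>_. 1"] assms(2)
  by simp

lemma positive_definite_kernel_hermitian:
  assumes K: "positive_definite_kernel N K" and words: "\<sigma> \<in> lists {1..N}" "\<tau> \<in> lists {1..N}"
  shows "K \<tau> \<sigma> = cnj (K \<sigma> \<tau>)"
proof -
  \<comment> \<open>The quadratic form of \<open>K\<close> on the words \<open>\<sigma>\<close>,
    \<open>\<tau>\<close> with coefficients 1 and \<open>z\<close>.\<close>
  have form: "0 \<le> K \<sigma> \<sigma> + K \<sigma> \<tau> * z + K \<tau> \<sigma> * cnj z + K \<tau> \<tau> * (z * cnj z)" for z
  proof -
    have "{1..2} = {1, 2::nat}"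
      by auto
    then show ?thesis
      using K[unfolded positive_definite_kernel_def, rule_format,
          of 2 "\<lambda>i. if i = 1 then \<sigma> else \<tau>" "\<lambda>i. if i = 1 then 1 else z"] words
      by (simp add: algebra_simps)
  qed
  \<comment> \<open>The form and the diagonal entries are real. Vanishing of the imaginary part at
    \<open>z = 1\<close> makes the imaginary parts of \<open>K \<sigma> \<tau>\<close> and
    \<open>K \<tau> \<sigma>\<close> opposite; at \<open>z = \<i>\<close> it makes their real parts
    equal.\<close>
  show ?thesis
    using form[of 1] form[of \<i>] positive_definite_kernel_diagonal[OF K words(1)]
      positive_definite_kernel_diagonal[OF K words(2)]
    by (simp add: less_eq_complex_def complex_eq_iff)
qed

text \<open>Equal first letters are cancelled by invariance; if they differ, neither word is a
  prefix of the other.\<close>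

lemma multi_Toeplitz_Cons:
  assumes "multi_Toeplitz N K" "a # \<sigma> \<in> lists {1..N}" "b # \<tau> \<in> lists {1..N}"
  shows "K (a # \<sigma>) (b # \<tau>) = (if a = b then K \<sigma> \<tau> else 0)"
proof (cases "a = b")
  case True
  then show ?thesis
    using assms(1)[unfolded multi_Toeplitz_def, THEN conjunct1, rule_format, of "[a]" \<sigma> \<tau>]
      assms(2,3) by simp
next
  case False
  then show ?thesis
    using assms(1)[unfolded multi_Toeplitz_def, THEN conjunct2, rule_format, of "a # \<sigma>" "b # \<tau>"]
      assms(2,3) by simp
qed

text \<open>The two columns of \<open>G\<close> agree below block row 0, so the signs in
  \<open>J_mat\<close> cancel their contributions when \<open>i\<close> and \<open>j\<close> are
  both positive. In block row 0 the second column is 0, so only the first contributes if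
  \<open>i\<close> or \<open>j\<close> is 0.\<close>

lemma index_G_J_G:
  assumes S: "\<And>i j. S i j \<in> carrier_mat (N ^ i) (N ^ j)"
    and p: "p < N ^ i" and q: "q < N ^ j"
  shows "GJG_array S i j $$ (p, q) =
    (if i = 0 \<and> j = 0 then 1
     else if i = 0 then S 0 j $$ (0, q)
     else if j = 0 then cnj (S 0 i $$ (0, p))
     else 0)"
proof -
  have G: "G_row S i \<in> carrier_mat (N ^ i) 2" for i
    using S[of 0 i] by (auto simp: G_row_def mat_of_rows_list_def)
  have G_index: "G_row S i $$ (p, c) =
      (if i = 0 then if c = 0 then 1 else 0 else cnj (S 0 i $$ (0, p)))"
    if "p < N ^ i" "c < 2" for i p c
    using S[of 0 i] that
    by (auto simp: G_row_def mat_of_rows_list_def mat_of_cols_def index_mat_adjoint less_2_cases_iff)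
  have "GJG_array S i j $$ (p, q)
      = (\<Sum>c<2. (\<Sum>d<2. G_row S i $$ (p, d) * J_mat $$ (d, c)) * cnj (G_row S j $$ (q, c)))"
    using G[of i] G[of j] p q
    by (auto simp: GJG_array_def scalar_prod_def index_mat_adjoint J_mat_def mat_of_rows_list_def
        lessThan_atLeast0, simp add: numeral_2_eq_2)
  also have "\<dots> = G_row S i $$ (p, 0) * cnj (G_row S j $$ (q, 0))
      - G_row S i $$ (p, 1) * cnj (G_row S j $$ (q, 1))"
    by (simp add: numeral_2_eq_2 J_mat_def mat_of_rows_list_def)
  finally show ?thesis
    using p q by (simp add: G_index)
qed

lemma GJG_array_carrier:
  assumes "\<And>i j. S i j \<in> carrier_mat (N ^ i) (N ^ j)"
  shows "GJG_array S i j \<in> carrier_mat (N ^ i) (N ^ j)"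
  using assms[of 0 i] assms[of 0 j]
  by (auto simp: GJG_array_def G_row_def mat_of_rows_list_def)

theorem theorem2p2:
  fixes N :: nat
    and K :: "nat list \<Rightarrow> nat list \<Rightarrow> complex"
    and S :: op_array
  assumes "N \<ge> 1"
    and "positive_definite_kernel N K"
    and "multi_Toeplitz N K"
    and "K [] [] = 1"
    and "S = kernel_array N K"
  shows "S - array_sum N
               (\<lambda>k. array_mult N (array_mult N (creation N k) S) (array_adjoint (creation N k)))
               {1..N}
         = GJG_array S"
proof (intro ext eq_matI)
  let ?F = "\<lambda>k. array_mult N (array_mult N (creation N k) S) (array_adjoint (creation N k))"
  have S: "S i j \<in> carrier_mat (N ^ i) (N ^ j)" for i j
    using assms(5) kernel_array_carrier by simp
  fix i j
  show "dim_row ((S - array_sum N ?F {1..N}) i j) = dim_row (GJG_array S i j)"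
    "dim_col ((S - array_sum N ?F {1..N}) i j) = dim_col (GJG_array S i j)"
    using GJG_array_carrier[of S N i j, OF S] by (auto simp: array_sum_def)
  fix p q
  assume "p < dim_row (GJG_array S i j)" "q < dim_col (GJG_array S i j)"
  then have p: "p < N ^ i" and q: "q < N ^ j"
    using GJG_array_carrier[of S N i j, OF S] by auto
  have diff: "(S - array_sum N ?F {1..N}) i j $$ (p, q)
      = S i j $$ (p, q) - (\<Sum>k=1..N. ?F k i j $$ (p, q))"
    using p q by (simp add: array_sum_def)
  show "(S - array_sum N ?F {1..N}) i j $$ (p, q) = GJG_array S i j $$ (p, q)"
  proof (cases "i = 0 \<or> j = 0")
    case True
    \<comment> \<open>Conjugation by \<open>creation N k\<close> raises both block indices by one,
      so it leaves block row 0 and block column 0 empty.\<close>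
    then have "(\<Sum>k=1..N. ?F k i j $$ (p, q)) = 0"
      by (intro sum.neutral ballI, subst index_creation_conjugate[OF S p q]) (auto split: nat.split)
    \<comment> \<open>This is for \<open>j = 0\<close>: block column 0 of \<open>S\<close> has
      entries \<open>K \<sigma> []\<close>, whereas \<open>G\<close> is built from the adjoint of
      block row 0.\<close>
    moreover have "K (words N i ! p) [] = cnj (K [] (words N i ! p))"
      by (rule positive_definite_kernel_hermitian[OF assms(2)]) (use nth_words_in_lists[OF p] in simp_all)
    ultimately show ?thesis
      unfolding diff index_G_J_G[OF S p q] using True p q assms(4)
      by (auto simp: assms(5) index_kernel_array)
  next
    case False
    then obtain i' j' where ij: "i = Suc i'" "j = Suc j'"
      by (meson not0_implies_Suc)
    have less: "p div N ^ i' < N" "p mod N ^ i' < N ^ i'" "q mod N ^ j' < N ^ j'"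
      using mod_power_less p q ij by auto
    let ?c = "if p div N ^ i' = q div N ^ j'
      then K (words N i' ! (p mod N ^ i')) (words N j' ! (q mod N ^ j')) else 0"
    have "S i j $$ (p, q) = ?c"
      using p q multi_Toeplitz_Cons[OF assms(3), of "Suc (p div N ^ i')" "words N i' ! (p mod N ^ i')"
          "Suc (q div N ^ j')" "words N j' ! (q mod N ^ j')"]
        nth_words_in_lists[OF p] nth_words_in_lists[OF q]
      by (simp add: ij assms(5) index_kernel_array nth_words_Suc del: power_Suc)
    \<comment> \<open>Only the first letter of the row word can contribute as \<open>k\<close>, and
      \<open>less\<close> puts it in the range of summation. The condition that the column word
      begins with the same letter is absorbed in \<open>?c\<close>.\<close>
    moreover have "(\<Sum>k=1..N. ?F k i j $$ (p, q)) = (\<Sum>k=1..N. if k = Suc (p div N ^ i') then ?c else 0)"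
      by (intro sum.cong refl, subst index_creation_conjugate[OF S p q])
        (use less in \<open>auto simp: ij assms(5) index_kernel_array\<close>)
    ultimately show ?thesis
      unfolding diff index_G_J_G[OF S p q] using False less by simp
  qed
qed

end
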